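(* Let $X\in\mathbb{R}^d$, $Y\in\mathbb{R}$, $H\in\mathbb{R}^q$, $I\in\mathbb{R}^m$ be generated by the linear structural causal model $$X := BX + AI + h(H,\epsilon^X),\qquad Y := X^\top\beta^* + g(H,\epsilon^Y),$$ where $B\in\mathbb{R}^{d\times d}$ with $\operatorname{Id}-B$ invertible, $A\in\mathbb{R}^{d\times m}$, $\beta^*\in\mathbb{R}^d$, $h,g$ are arbitrary measurable functions, $I,H,\epsilon^X,\epsilon^Y$ are jointly independent, and $\operatorname{Cov}[I]$ is invertible. Let $C:=A^\top(\operatorname{Id}-B)^{-\top}\in\mathbb{R}^{m\times d}$ and $\mathcal{B}:=\{\beta\in\mathbb{R}^d : \operatorname{Cov}(I,X)\beta=\operatorname{Cov}(I,Y)\}$. Then for every $j\in\{1,\dots,d\}$: $$\beta^*_j \text{ is identifiable by the moment condition } \operatorname{Cov}(I,Y-X^\top\beta)=0 \iff \operatorname{Null}(C)_j=\{0\},$$ where $\operatorname{Null}(C)_j=\{w_j : w\in\operatorname{Null}(C)\}$. Moreover, whenever $\operatorname{Null}(C)_j=\{0\}$, it holds that $\beta^*_j=\big(\operatorname{Cov}(I,X)^{\dagger}\operatorname{Cov}(I,Y)\big)_j$, where $(\cdot)^\dagger$ denotes the Moore–Penrose inverse.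
   Context: "$\beta^*_j$ is identifiable by the moment condition" means that every $\beta\in\mathcal{B}$ (the solution set of $\operatorname{Cov}(I,Y-X^\top\beta)=0$) satisfies $\beta_j=\beta^*_j$, i.e. $\{\beta_j:\beta\in\mathcal{B}\}=\{\beta^*_j\}$. All covariances involved are assumed to exist. $M^{-\top}$ denotes $(M^{-1})^\top$. *)

theory Defs
  imports "HOL-Analysis.Analysis" "HOL-Probability.Probability"
begin

text \<open>Covariance of two real random variables (centred form).\<close>
definition covar :: "'a measure \<Rightarrow> ('a \<Rightarrow> real) \<Rightarrow> ('a \<Rightarrow> real) \<Rightarrow> real" where
  "covar M U V = (\<integral>\<omega>. (U \<omega> - (\<integral>\<omega>'. U \<omega>' \<partial>M)) * (V \<omega> - (\<integral>\<omega>'. V \<omega>' \<partial>M)) \<partial>M)"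

text \<open>Cross-covariance matrix Cov(U,V), entry (i,k) = Cov(U_i, V_k).\<close>
definition cov_mat :: "'a measure \<Rightarrow> ('a \<Rightarrow> real^'m) \<Rightarrow> ('a \<Rightarrow> real^'n) \<Rightarrow> real^'n^'m" where
  "cov_mat M U V = (\<chi> i k. covar M (\<lambda>\<omega>. U \<omega> $ i) (\<lambda>\<omega>. V \<omega> $ k))"

text \<open>Covariance vector Cov(U,W) for a vector U and a scalar W.\<close>
definition cov_vec :: "'a measure \<Rightarrow> ('a \<Rightarrow> real^'m) \<Rightarrow> ('a \<Rightarrow> real) \<Rightarrow> real^'m" where
  "cov_vec M U W = (\<chi> i. covar M (\<lambda>\<omega>. U \<omega> $ i) W)"

text \<open>Moore--Penrose inverse, via the four Penrose conditions.\<close>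
definition moore_penrose :: "real^'n^'m \<Rightarrow> real^'m^'n" where
  "moore_penrose Q = (THE G. Q ** G ** Q = Q \<and> G ** Q ** G = G \<and>
      transpose (Q ** G) = Q ** G \<and> transpose (G ** Q) = G ** Q)"

text \<open>Joint independence of four random variables with possibly different codomains
  (literally the unfolding of indep_vars, with index set {0,1,2,3}).\<close>
definition indep4 :: "'a measure \<Rightarrow> ('a \<Rightarrow> 'b) \<Rightarrow> 'b measure \<Rightarrow> ('a \<Rightarrow> 'c) \<Rightarrow> 'c measure
    \<Rightarrow> ('a \<Rightarrow> 'd) \<Rightarrow> 'd measure \<Rightarrow> ('a \<Rightarrow> 'e) \<Rightarrow> 'e measure \<Rightarrow> bool" where
  "indep4 M V1 N1 V2 N2 V3 N3 V4 N4 \<longleftrightarrow>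
     V1 \<in> measurable M N1 \<and> V2 \<in> measurable M N2 \<and> V3 \<in> measurable M N3 \<and> V4 \<in> measurable M N4 \<and>
     prob_space.indep_sets M
       (\<lambda>i::nat. [ {V1 -` A \<inter> space M | A. A \<in> sets N1}, {V2 -` A \<inter> space M | A. A \<in> sets N2},
                  {V3 -` A \<inter> space M | A. A \<in> sets N3}, {V4 -` A \<inter> space M | A. A \<in> sets N4} ] ! i)
       {0..<4}"

text \<open>Solution set of the moment condition Cov(I, Y - X^T beta) = 0.\<close>
definition moment_solutions :: "'a measure \<Rightarrow> ('a \<Rightarrow> real^'m) \<Rightarrow> ('a \<Rightarrow> real^'d) \<Rightarrow> ('a \<Rightarrow> real) \<Rightarrow> (real^'d) set" where
  "moment_solutions M I X Y = {\<beta>. \<forall>i. covar M (\<lambda>\<omega>. I \<omega> $ i) (\<lambda>\<omega>. Y \<omega> - X \<omega> \<bullet> \<beta>) = 0}"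

text \<open>beta*_j is identifiable by the moment condition.\<close>
definition identifiable_coord :: "'a measure \<Rightarrow> ('a \<Rightarrow> real^'m) \<Rightarrow> ('a \<Rightarrow> real^'d) \<Rightarrow> ('a \<Rightarrow> real) \<Rightarrow> real^'d \<Rightarrow> 'd \<Rightarrow> bool" where
  "identifiable_coord M I X Y \<beta>s j \<longleftrightarrow> {\<beta> $ j | \<beta>. \<beta> \<in> moment_solutions M I X Y} = {\<beta>s $ j}"

text \<open>Null(C)_j = {w_j : C w = 0}.\<close>
definition null_coord :: "real^'d^'m \<Rightarrow> 'd \<Rightarrow> real set" where
  "null_coord C j = {w $ j | w. C *v w = 0}"

end

theory Submission
  imports Defs
begin

(* The errors h(H, eps^X) and g(H, eps^Y) are functions of (H, eps^X) and (H, eps^Y), both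
   independent of I, so I is uncorrelated with them. Applying Cov(I, -) to
   (Id - B) X = A I + h(H, eps^X) gives Cov(I,X) (Id - B)^T = Cov(I) A^T, i.e. Cov(I,X) = Cov(I) C,
   and applying it to Y - X^T beta = X^T (beta* - beta) + g(H, eps^Y) gives
   Cov(I, Y - X^T beta) = Cov(I) C (beta* - beta). Since Cov(I) is invertible, the moment
   condition holds exactly for beta in beta* - Null(C), whose j-th coordinates form
   beta*_j - Null(C)_j.
   For Q = Cov(I,X), any Q^- with Q Q^- Q = Q sends Cov(I,Y) = Q beta* into
   beta* + Null(Q) = beta* + Null(C); the Moore-Penrose inverse is such a Q^-. It exists because
   every Q^- = Q^T W with Q^T Q Q^- = Q^T satisfies the four Penrose conditions, and such a W
   exists since range(Q^T Q Q^T) = range(Q^T). *)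

definition penrose_conditions :: "real^'n^'m \<Rightarrow> real^'m^'n \<Rightarrow> bool" where
  "penrose_conditions Q G \<longleftrightarrow> Q ** G ** Q = Q \<and> G ** Q ** G = G \<and>
     transpose (Q ** G) = Q ** G \<and> transpose (G ** Q) = G ** Q"

lemma penrose_conditions_unique:
  assumes "penrose_conditions Q G1" "penrose_conditions Q G2"
  shows "G1 = G2"
proof -
  from assms(1) have a1: "Q ** G1 ** Q = Q" "G1 ** Q ** G1 = G1"
    "transpose (Q ** G1) = Q ** G1" "transpose (G1 ** Q) = G1 ** Q"
    unfolding penrose_conditions_def by auto
  from assms(2) have a2: "Q ** G2 ** Q = Q" "G2 ** Q ** G2 = G2"
    "transpose (Q ** G2) = Q ** G2" "transpose (G2 ** Q) = G2 ** Q"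
    unfolding penrose_conditions_def by auto
  have "G1 = G1 ** transpose (Q ** G1)" using a1(2,3) by (simp add: matrix_mul_assoc)
  also have "\<dots> = G1 ** transpose G1 ** transpose (Q ** G2 ** Q)"
    using a2(1) by (simp add: matrix_transpose_mul matrix_mul_assoc)
  also have "\<dots> = G1 ** (transpose (Q ** G1) ** transpose (Q ** G2))"
    by (simp add: matrix_transpose_mul matrix_mul_assoc)
  also have "\<dots> = G1 ** Q ** G2" using a1(1,3) a2(3) by (simp add: matrix_mul_assoc)
  finally have G1_eq: "G1 = G1 ** Q ** G2" .
  have "G2 = transpose (G2 ** Q) ** G2" using a2(2,4) by (simp add: matrix_mul_assoc)
  also have "\<dots> = transpose (Q ** G1 ** Q) ** transpose G2 ** G2"
    using a1(1) by (simp add: matrix_transpose_mul)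
  also have "\<dots> = (transpose (G1 ** Q) ** transpose (G2 ** Q)) ** G2"
    by (simp add: matrix_transpose_mul matrix_mul_assoc)
  also have "\<dots> = G1 ** Q ** (G2 ** Q ** G2)" using a1(4) a2(4) by (simp add: matrix_mul_assoc)
  finally show ?thesis using G1_eq a2(2) by simp
qed

lemma range_matrix_mul_subset: "range ((*v) (P ** R)) \<subseteq> range ((*v) P)"
  by (auto simp flip: matrix_vector_mul_assoc)

lemma range_matrix_mul_transpose:
  fixes P :: "real^'n^'m"
  shows "range ((*v) (P ** transpose P)) = range ((*v) P)"
proof
  show "range ((*v) P) \<subseteq> range ((*v) (P ** transpose P))"
  proof clarify
    fix x
    have "subspace (range ((*v) (transpose P)))"
      by (rule linear_subspace_image[OF matrix_vector_mul_linear subspace_UNIV])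
    then have span_eq: "span (range ((*v) (transpose P))) = range ((*v) (transpose P))"
      by (rule span_eq_iff[THEN iffD2])
    obtain y z where y: "y \<in> range ((*v) (transpose P))"
      and z: "\<And>w. w \<in> range ((*v) (transpose P)) \<Longrightarrow> orthogonal z w" and x: "x = y + z"
      using orthogonal_subspace_decomp_exists[of "range ((*v) (transpose P))" x]
      unfolding span_eq by blast
    have "(P *v z) \<bullet> (P *v z) = z \<bullet> (transpose P *v (P *v z))"
      by (metis dot_lmul_matrix inner_commute transpose_matrix_vector)
    also have "\<dots> = 0" using z[of "transpose P *v (P *v z)"] by (simp add: orthogonal_def)
    finally have "P *v x = P *v y" using x by (simp add: matrix_vector_right_distrib)
    with y show "P *v x \<in> range ((*v) (P ** transpose P))"
      by (auto simp flip: matrix_vector_mul_assoc)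
  qed
qed (rule range_matrix_mul_subset)

lemma matrix_factor_through_range:
  fixes M :: "real^'k^'m" and N :: "real^'n^'m"
  assumes "range ((*v) N) \<subseteq> range ((*v) M)"
  shows "\<exists>W. M ** W = N"
proof -
  define f where "f k = inv ((*v) M) (N *v axis k 1)" for k
  have f: "M *v f k = column k N" for k
    unfolding f_def matrix_vector_mult_basis[symmetric] using assms by (blast intro: f_inv_into_f)
  have "(M ** (\<chi> j k. f k $ j)) $ i $ k = N $ i $ k" for i k
  proof -
    have "(M ** (\<chi> j k. f k $ j)) $ i $ k = (M *v f k) $ i"
      by (simp add: matrix_matrix_mult_def matrix_vector_mult_def)
    then show ?thesis using f by (simp add: column_def)
  qed
  then show ?thesis by (auto simp: vec_eq_iff)
qed

lemma penrose_conditions_normal_equation: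
  fixes Q :: "real^'n^'m"
  assumes normal: "transpose Q ** Q ** G = transpose Q" and row: "G = transpose Q ** W"
  shows "penrose_conditions Q G"
proof -
  define P where "P = Q ** G"
  define E where "E = G ** Q"
  have PQ: "transpose P ** Q = Q"
    using arg_cong[OF normal, of transpose]
    by (simp add: P_def matrix_transpose_mul matrix_mul_assoc)
  have "transpose P ** P = (transpose P ** Q) ** G" by (simp add: P_def matrix_mul_assoc)
  then have "transpose P ** P = P" using PQ by (simp add: P_def)
  then have P_sym: "transpose P = P"
    by (metis matrix_transpose_mul transpose_transpose)
  have QGQ: "Q ** G ** Q = Q" using PQ P_sym by (simp add: P_def)
  have "transpose Q ** transpose W ** Q ** transpose Q = transpose Q"
    using arg_cong[OF QGQ, of transpose] by (simp add: row matrix_transpose_mul matrix_mul_assoc)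
  then have "transpose E ** E = E"
    by (simp add: E_def row matrix_transpose_mul matrix_mul_assoc)
  then have E_sym: "transpose E = E"
    by (metis matrix_transpose_mul transpose_transpose)
  have "G ** Q ** G = transpose (Q ** transpose E) ** W"
    by (simp add: E_def row matrix_transpose_mul matrix_mul_assoc)
  also have "\<dots> = transpose (Q ** G ** Q) ** W"
    by (simp only: E_sym) (simp add: E_def matrix_mul_assoc)
  also have "\<dots> = G" using QGQ by (simp add: row)
  finally show ?thesis
    unfolding penrose_conditions_def using QGQ P_sym E_sym by (simp add: P_def E_def)
qed

lemma penrose_conditions_exist: "\<exists>G. penrose_conditions (Q :: real^'n^'m) G"
proof -
  have "range ((*v) (transpose Q)) =
      range ((*v) (transpose Q ** Q ** transpose (transpose Q ** Q)))"
    using range_matrix_mul_transpose[of "transpose Q"]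
      range_matrix_mul_transpose[of "transpose Q ** Q"] by simp
  also have "\<dots> \<subseteq> range ((*v) (transpose Q ** Q ** transpose Q))"
    using range_matrix_mul_subset[of "transpose Q ** Q ** transpose Q" Q]
    by (simp add: matrix_transpose_mul matrix_mul_assoc)
  finally obtain W where "transpose Q ** Q ** transpose Q ** W = transpose Q"
    using matrix_factor_through_range by blast
  then have "penrose_conditions Q (transpose Q ** W)"
    by (intro penrose_conditions_normal_equation) (simp_all add: matrix_mul_assoc)
  then show ?thesis ..
qed

lemma penrose_conditions_moore_penrose: "penrose_conditions Q (moore_penrose Q)"
proof -
  have "\<exists>!G. penrose_conditions Q G"
    using penrose_conditions_exist penrose_conditions_unique by blast
  then show ?thesis
    unfolding moore_penrose_def penrose_conditions_def[symmetric] by (rule theI')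
qed

lemma generalized_inverse_coord:
  fixes Q :: "real^'n^'m"
  assumes "Q ** G ** Q = Q" and "null_coord Q j = {0}"
  shows "(G *v (Q *v b)) $ j = b $ j"
proof -
  have "Q *v (G *v (Q *v b) - b) = 0"
    using assms(1) by (simp add: matrix_vector_mult_diff_distrib matrix_vector_mul_assoc
        flip: matrix_mul_assoc)
  then have "(G *v (Q *v b) - b) $ j \<in> null_coord Q j" unfolding null_coord_def by blast
  then show ?thesis using assms(2) by simp
qed

lemma null_coord_invertible_mult:
  fixes S :: "real^'m^'m"
  assumes "invertible S"
  shows "null_coord (S ** C) j = null_coord C j"
proof -
  have "(S ** C) *v w = 0 \<longleftrightarrow> C *v w = 0" for w
    using inj_matrix_vector_mult[OF assms]
    by (metis injD matrix_vector_mul_assoc matrix_vector_mult_0_right)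
  then show ?thesis unfolding null_coord_def by simp
qed

lemma solution_coords_eq_singleton_iff:
  "{\<beta> $ j | \<beta>. C *v (b - \<beta>) = 0} = {b $ j} \<longleftrightarrow> null_coord C j = {0}"
proof -
  have "{\<beta> $ j | \<beta>. C *v (b - \<beta>) = 0} = (\<lambda>t. b $ j - t) ` null_coord C j"
    unfolding null_coord_def by (force intro: exI[of _ "b - w" for w])
  moreover have "{b $ j} = (\<lambda>t. b $ j - t) ` {0}" by simp
  moreover have "inj (\<lambda>t::real. b $ j - t)" by (rule injI) simp
  ultimately show ?thesis by (simp only: inj_image_eq_iff)
qed

lemma matrix_inv_left:
  assumes "invertible R"
  shows "matrix_inv R ** R = mat 1"
  using assms unfolding invertible_def matrix_inv_def by (rule someI_ex[THEN conjunct2])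

lemma eq_mult_transpose_matrix_inv:
  fixes R :: "real^'n^'n"
  assumes "invertible R" and "K ** transpose R = N"
  shows "K = N ** transpose (matrix_inv R)"
proof -
  have "transpose R ** transpose (matrix_inv R) = mat 1"
    using matrix_inv_left[OF assms(1)] by (metis matrix_transpose_mul transpose_mat)
  then show ?thesis using assms(2) by (metis matrix_mul_assoc matrix_mul_rid)
qed

lemma borel_measurable_vec_nth: "(\<lambda>x::real^'n. x $ i) \<in> borel_measurable borel"
  by (intro borel_measurable_continuous_onI continuous_on_component continuous_on_id)

definition cov_integrable :: "'a measure \<Rightarrow> ('a \<Rightarrow> real) \<Rightarrow> ('a \<Rightarrow> real) \<Rightarrow> bool" where
  "cov_integrable M U V \<longleftrightarrow> integrable M U \<and> integrable M V \<and> integrable M (\<lambda>\<omega>. U \<omega> * V \<omega>)"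

lemma cov_integrable_add_right:
  assumes "cov_integrable M U V" and "cov_integrable M U V'"
  shows "cov_integrable M U (\<lambda>\<omega>. V \<omega> + V' \<omega>)"
  using assms unfolding cov_integrable_def by (simp add: distrib_left)

lemma cov_integrable_sum_right:
  assumes "integrable M U" and "\<And>l. l \<in> S \<Longrightarrow> cov_integrable M U (V l)"
  shows "cov_integrable M U (\<lambda>\<omega>. \<Sum>l\<in>S. c l * V l \<omega>)"
proof -
  have "integrable M (\<lambda>\<omega>. \<Sum>l\<in>S. c l * (U \<omega> * V l \<omega>))"
    using assms(2) unfolding cov_integrable_def by auto
  then show ?thesis
    using assms unfolding cov_integrable_def by (auto simp: sum_distrib_left ac_simps)
qed

lemma abs_mult_le_sum_squares: "\<bar>(u::real) * v\<bar> \<le> u\<^sup>2 + v\<^sup>2"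
proof -
  have "2 * (\<bar>u\<bar> * \<bar>v\<bar>) \<le> u\<^sup>2 + v\<^sup>2"
    using sum_squares_bound[of "\<bar>u\<bar>" "\<bar>v\<bar>"] by (simp add: mult.assoc)
  moreover have "0 \<le> \<bar>u\<bar> * \<bar>v\<bar>" by simp
  ultimately show ?thesis unfolding abs_mult by linarith
qed

lemma cov_integrable_square:
  fixes U V :: "'a \<Rightarrow> real"
  assumes "integrable M U" "integrable M (\<lambda>\<omega>. (U \<omega>)\<^sup>2)"
    and "integrable M V" "integrable M (\<lambda>\<omega>. (V \<omega>)\<^sup>2)"
  shows "cov_integrable M U V"
proof -
  have "integrable M (\<lambda>\<omega>. U \<omega> * V \<omega>)"
  proof (rule Bochner_Integration.integrable_bound)
    show "integrable M (\<lambda>\<omega>. (U \<omega>)\<^sup>2 + (V \<omega>)\<^sup>2)"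
      using assms(2,4) by (rule Bochner_Integration.integrable_add)
    show "(\<lambda>\<omega>. U \<omega> * V \<omega>) \<in> borel_measurable M"
      using assms(1,3) by (intro borel_measurable_times borel_measurable_integrable)
    show "AE \<omega> in M. norm (U \<omega> * V \<omega>) \<le> norm ((U \<omega>)\<^sup>2 + (V \<omega>)\<^sup>2)"
      using abs_mult_le_sum_squares by simp
  qed
  then show ?thesis using assms(1,3) unfolding cov_integrable_def by simp
qed

lemma cov_integrable_indep:
  assumes "prob_space M" and "prob_space.indep_var M borel U borel V"
    and "integrable M U" and "integrable M V"
  shows "cov_integrable M U V"
  using prob_space.indep_var_integrable[OF assms] assms unfolding cov_integrable_def by simp

lemma covar_eq_integral:
  assumes "prob_space M" and "cov_integrable M U V"
  shows "covar M U V = (\<integral>\<omega>. U \<omega> * V \<omega> \<partial>M) - (\<integral>\<omega>. U \<omega> \<partial>M) * (\<integral>\<omega>. V \<omega> \<partial>M)"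
proof -
  interpret prob_space M by fact
  define a b where "a = (\<integral>\<omega>. U \<omega> \<partial>M)" and "b = (\<integral>\<omega>. V \<omega> \<partial>M)"
  have "covar M U V = (\<integral>\<omega>. U \<omega> * V \<omega> - b * U \<omega> - a * V \<omega> + a * b \<partial>M)"
    unfolding covar_def a_def[symmetric] b_def[symmetric] by (simp add: algebra_simps)
  also have "\<dots> = (\<integral>\<omega>. U \<omega> * V \<omega> \<partial>M) - b * a - a * b + a * b"
    using assms(2) unfolding cov_integrable_def by (simp add: a_def b_def prob_space)
  finally show ?thesis by (simp add: a_def b_def)
qed

lemma covar_add_right:
  assumes "prob_space M" and "cov_integrable M U V" and "cov_integrable M U V'"
  shows "covar M U (\<lambda>\<omega>. V \<omega> + V' \<omega>) = covar M U V + covar M U V'"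
proof -
  from assms(2,3) have "integrable M V" "integrable M V'"
    "integrable M (\<lambda>\<omega>. U \<omega> * V \<omega>)" "integrable M (\<lambda>\<omega>. U \<omega> * V' \<omega>)"
    unfolding cov_integrable_def by auto
  then show ?thesis
    using covar_eq_integral[OF assms(1) cov_integrable_add_right[OF assms(2,3)]]
    by (simp add: covar_eq_integral[OF assms(1)] assms(2,3) distrib_left algebra_simps)
qed

lemma covar_sum_right:
  assumes "prob_space M" and "integrable M U" and "\<And>l. l \<in> S \<Longrightarrow> cov_integrable M U (V l)"
  shows "covar M U (\<lambda>\<omega>. \<Sum>l\<in>S. c l * V l \<omega>) = (\<Sum>l\<in>S. c l * covar M U (V l))"
proof -
  have int: "integrable M (\<lambda>\<omega>. U \<omega> * V l \<omega>)" "integrable M (V l)"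
    if "l \<in> S" for l using assms(3)[OF that] unfolding cov_integrable_def by auto
  have "covar M U (\<lambda>\<omega>. \<Sum>l\<in>S. c l * V l \<omega>) =
      (\<integral>\<omega>. (\<Sum>l\<in>S. c l * (U \<omega> * V l \<omega>)) \<partial>M)
      - (\<integral>\<omega>. U \<omega> \<partial>M) * (\<integral>\<omega>. (\<Sum>l\<in>S. c l * V l \<omega>) \<partial>M)"
    by (simp add: covar_eq_integral[OF assms(1) cov_integrable_sum_right[OF assms(2,3)]]
        sum_distrib_left ac_simps)
  also have "\<dots> = (\<Sum>l\<in>S. c l * (\<integral>\<omega>. U \<omega> * V l \<omega> \<partial>M))
      - (\<integral>\<omega>. U \<omega> \<partial>M) * (\<Sum>l\<in>S. c l * (\<integral>\<omega>. V l \<omega> \<partial>M))"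
    using int by (simp add: Bochner_Integration.integral_sum)
  also have "\<dots> = (\<Sum>l\<in>S. c l * covar M U (V l))"
    using assms(3) by (simp add: covar_eq_integral[OF assms(1)] sum_distrib_left
        sum_subtractf right_diff_distrib ac_simps)
  finally show ?thesis .
qed

lemma covar_cong_right:
  assumes "\<And>\<omega>. \<omega> \<in> space M \<Longrightarrow> V \<omega> = V' \<omega>"
  shows "covar M U V = covar M U V'"
  unfolding covar_def using assms by (simp cong: Bochner_Integration.integral_cong)

lemma covar_indep_eq_0:
  assumes "prob_space M" and "prob_space.indep_var M borel U borel V"
    and "integrable M U" and "integrable M V"
  shows "covar M U V = 0"
proof -
  interpret prob_space M by fact
  define a b where "a = (\<integral>\<omega>. U \<omega> \<partial>M)" and "b = (\<integral>\<omega>. V \<omega> \<partial>M)"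
  have "indep_var borel (\<lambda>\<omega>. U \<omega> - a) borel (\<lambda>\<omega>. V \<omega> - b)"
    using indep_var_compose[OF assms(2), of "\<lambda>x. x - a" borel "\<lambda>x. x - b" borel]
    by (simp add: comp_def)
  then have "covar M U V = (\<integral>\<omega>. U \<omega> - a \<partial>M) * (\<integral>\<omega>. V \<omega> - b \<partial>M)"
    unfolding covar_def a_def[symmetric] b_def[symmetric]
    by (rule indep_var_lebesgue_integral) (use assms in auto)
  also have "\<dots> = 0" using assms(3) by (simp add: a_def prob_space)
  finally show ?thesis .
qed

lemma cov_integrable_matrix_vector_mult_right:
  assumes "\<And>k. cov_integrable M U (\<lambda>\<omega>. V \<omega> $ k)"
  shows "cov_integrable M U (\<lambda>\<omega>. (L *v V \<omega>) $ l)"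
  unfolding matrix_vector_mult_def vec_lambda_beta
  by (rule cov_integrable_sum_right) (use assms in \<open>auto simp: cov_integrable_def\<close>)

lemma cov_integrable_inner_right:
  assumes "\<And>k. cov_integrable M U (\<lambda>\<omega>. V \<omega> $ k)"
  shows "cov_integrable M U (\<lambda>\<omega>. V \<omega> \<bullet> b)"
  using cov_integrable_sum_right[of M U UNIV "\<lambda>k \<omega>. V \<omega> $ k" "\<lambda>k. b $ k"] assms
  by (simp add: inner_vec_def cov_integrable_def mult.commute)

lemma cov_mat_cong_right:
  assumes "\<And>\<omega>. \<omega> \<in> space M \<Longrightarrow> V \<omega> = V' \<omega>"
  shows "cov_mat M U V = cov_mat M U V'"
  unfolding cov_mat_def using assms by (simp cong: covar_cong_right)

lemma cov_vec_cong_right: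
  assumes "\<And>\<omega>. \<omega> \<in> space M \<Longrightarrow> V \<omega> = V' \<omega>"
  shows "cov_vec M U V = cov_vec M U V'"
  unfolding cov_vec_def using assms by (simp cong: covar_cong_right)

lemma cov_mat_matrix_vector_mult_right:
  assumes "prob_space M" and "\<And>i k. cov_integrable M (\<lambda>\<omega>. U \<omega> $ i) (\<lambda>\<omega>. V \<omega> $ k)"
  shows "cov_mat M U (\<lambda>\<omega>. L *v V \<omega>) = cov_mat M U V ** transpose L"
proof -
  have "covar M (\<lambda>\<omega>. U \<omega> $ i) (\<lambda>\<omega>. (L *v V \<omega>) $ l)
      = (\<Sum>k\<in>UNIV. L $ l $ k * covar M (\<lambda>\<omega>. U \<omega> $ i) (\<lambda>\<omega>. V \<omega> $ k))" for i l
    unfolding matrix_vector_mult_def vec_lambda_beta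
    by (rule covar_sum_right[OF assms(1)]) (use assms(2) in \<open>auto simp: cov_integrable_def\<close>)
  then show ?thesis
    by (simp add: cov_mat_def matrix_matrix_mult_def transpose_def vec_eq_iff mult.commute)
qed

lemma cov_mat_add_right:
  assumes "prob_space M"
    and "\<And>i k. cov_integrable M (\<lambda>\<omega>. U \<omega> $ i) (\<lambda>\<omega>. V \<omega> $ k)"
    and "\<And>i k. cov_integrable M (\<lambda>\<omega>. U \<omega> $ i) (\<lambda>\<omega>. V' \<omega> $ k)"
  shows "cov_mat M U (\<lambda>\<omega>. V \<omega> + V' \<omega>) = cov_mat M U V + cov_mat M U V'"
  using covar_add_right[OF assms] by (simp add: cov_mat_def vec_eq_iff)

lemma cov_vec_inner_right:
  assumes "prob_space M" and "\<And>i k. cov_integrable M (\<lambda>\<omega>. U \<omega> $ i) (\<lambda>\<omega>. V \<omega> $ k)"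
  shows "cov_vec M U (\<lambda>\<omega>. V \<omega> \<bullet> b) = cov_mat M U V *v b"
proof -
  have "covar M (\<lambda>\<omega>. U \<omega> $ i) (\<lambda>\<omega>. V \<omega> \<bullet> b)
      = (\<Sum>k\<in>UNIV. b $ k * covar M (\<lambda>\<omega>. U \<omega> $ i) (\<lambda>\<omega>. V \<omega> $ k))" for i
    unfolding inner_vec_def inner_real_def
    using covar_sum_right[OF assms(1), of "\<lambda>\<omega>. U \<omega> $ i" UNIV "\<lambda>k \<omega>. V \<omega> $ k" "\<lambda>k. b $ k"]
      assms(2) by (simp add: cov_integrable_def mult.commute)
  then show ?thesis
    by (simp add: cov_vec_def cov_mat_def matrix_vector_mult_def vec_eq_iff mult.commute)
qed

lemma cov_vec_add_right:
  assumes "prob_space M"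
    and "\<And>i. cov_integrable M (\<lambda>\<omega>. U \<omega> $ i) V"
    and "\<And>i. cov_integrable M (\<lambda>\<omega>. U \<omega> $ i) V'"
  shows "cov_vec M U (\<lambda>\<omega>. V \<omega> + V' \<omega>) = cov_vec M U V + cov_vec M U V'"
  using covar_add_right[OF assms] by (simp add: cov_vec_def vec_eq_iff)

lemma cov_mat_structural_equation:
  fixes I :: "'a \<Rightarrow> real^'m" and X W :: "'a \<Rightarrow> real^'d"
  assumes P: "prob_space M"
    and X_eq: "\<forall>\<omega>\<in>space M. X \<omega> = B *v X \<omega> + A *v I \<omega> + W \<omega>"
    and IX: "\<And>i k. cov_integrable M (\<lambda>\<omega>. I \<omega> $ i) (\<lambda>\<omega>. X \<omega> $ k)"
    and II: "\<And>i p. cov_integrable M (\<lambda>\<omega>. I \<omega> $ i) (\<lambda>\<omega>. I \<omega> $ p)"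
    and indep: "\<And>i l. prob_space.indep_var M borel (\<lambda>\<omega>. I \<omega> $ i) borel (\<lambda>\<omega>. W \<omega> $ l)"
  shows "cov_mat M I X ** transpose (mat 1 - B) = cov_mat M I I ** transpose A"
proof -
  have I_int: "integrable M (\<lambda>\<omega>. I \<omega> $ i)" for i
    using II[of i i] by (simp add: cov_integrable_def)
  have AI: "cov_integrable M (\<lambda>\<omega>. I \<omega> $ i) (\<lambda>\<omega>. (A *v I \<omega>) $ l)" for i l
    using II by (rule cov_integrable_matrix_vector_mult_right)
  have W_eq: "W \<omega> = X \<omega> - B *v X \<omega> - A *v I \<omega>" if "\<omega> \<in> space M" for \<omega>
  proof -
    from bspec[OF X_eq that] have X_sum: "B *v X \<omega> + A *v I \<omega> + W \<omega> = X \<omega>" by (rule sym)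
    have "W \<omega> = (B *v X \<omega> + A *v I \<omega> + W \<omega>) - B *v X \<omega> - A *v I \<omega>" by simp
    then show ?thesis by (simp only: X_sum)
  qed
  have "integrable M (\<lambda>\<omega>. W \<omega> $ l) \<longleftrightarrow>
      integrable M (\<lambda>\<omega>. X \<omega> $ l - (B *v X \<omega>) $ l - (A *v I \<omega>) $ l)" for l
    by (rule Bochner_Integration.integrable_cong) (simp_all add: W_eq)
  then have W_int: "integrable M (\<lambda>\<omega>. W \<omega> $ l)" for l
    using IX[of undefined l] cov_integrable_matrix_vector_mult_right[OF IX, where L = B and l = l]
      AI[of undefined l]
    by (simp add: cov_integrable_def)
  have IW: "cov_integrable M (\<lambda>\<omega>. I \<omega> $ i) (\<lambda>\<omega>. W \<omega> $ l)" for i l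
    using cov_integrable_indep[OF P indep I_int W_int] .
  have "cov_mat M I W = 0"
    using covar_indep_eq_0[OF P indep I_int W_int] by (simp add: cov_mat_def vec_eq_iff)
  have "cov_mat M I X ** transpose (mat 1 - B) = cov_mat M I (\<lambda>\<omega>. (mat 1 - B) *v X \<omega>)"
    by (rule cov_mat_matrix_vector_mult_right[OF P IX, symmetric])
  also have "\<dots> = cov_mat M I (\<lambda>\<omega>. A *v I \<omega> + W \<omega>)"
    by (intro cov_mat_cong_right) (simp add: W_eq matrix_vector_mult_diff_rdistrib)
  also have "\<dots> = cov_mat M I (\<lambda>\<omega>. A *v I \<omega>) + cov_mat M I W"
    by (rule cov_mat_add_right[OF P AI IW])
  also have "\<dots> = cov_mat M I I ** transpose A"
    using \<open>cov_mat M I W = 0\<close> by (simp add: cov_mat_matrix_vector_mult_right[OF P II])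
  finally show ?thesis .
qed

lemma cov_vec_structural_equation:
  fixes I :: "'a \<Rightarrow> real^'m" and X :: "'a \<Rightarrow> real^'d"
  assumes P: "prob_space M"
    and Y_eq: "\<forall>\<omega>\<in>space M. Y \<omega> = X \<omega> \<bullet> \<beta>s + G \<omega>"
    and IX: "\<And>i k. cov_integrable M (\<lambda>\<omega>. I \<omega> $ i) (\<lambda>\<omega>. X \<omega> $ k)"
    and Y_int: "integrable M Y"
    and indep: "\<And>i. prob_space.indep_var M borel (\<lambda>\<omega>. I \<omega> $ i) borel G"
  shows "cov_vec M I (\<lambda>\<omega>. Y \<omega> - X \<omega> \<bullet> \<beta>) = cov_mat M I X *v (\<beta>s - \<beta>)"
proof -
  have I_int: "integrable M (\<lambda>\<omega>. I \<omega> $ i)" for i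
    using IX[of i undefined] by (simp add: cov_integrable_def)
  have "integrable M G \<longleftrightarrow> integrable M (\<lambda>\<omega>. Y \<omega> - X \<omega> \<bullet> \<beta>s)"
    by (rule Bochner_Integration.integrable_cong) (simp_all add: Y_eq)
  then have G_int: "integrable M G"
    using Y_int cov_integrable_inner_right[OF IX, of undefined \<beta>s] by (simp add: cov_integrable_def)
  have IG: "cov_integrable M (\<lambda>\<omega>. I \<omega> $ i) G" for i
    using cov_integrable_indep[OF P indep I_int G_int] .
  have "cov_vec M I G = 0"
    using covar_indep_eq_0[OF P indep I_int G_int] by (simp add: cov_vec_def vec_eq_iff)
  have "cov_vec M I (\<lambda>\<omega>. Y \<omega> - X \<omega> \<bullet> \<beta>) = cov_vec M I (\<lambda>\<omega>. X \<omega> \<bullet> (\<beta>s - \<beta>) + G \<omega>)"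
    using Y_eq by (intro cov_vec_cong_right) (simp add: inner_diff_right)
  also have "\<dots> = cov_vec M I (\<lambda>\<omega>. X \<omega> \<bullet> (\<beta>s - \<beta>)) + cov_vec M I G"
    using IX by (intro cov_vec_add_right[OF P] IG cov_integrable_inner_right)
  also have "\<dots> = cov_mat M I X *v (\<beta>s - \<beta>)"
    using \<open>cov_vec M I G = 0\<close> by (simp add: cov_vec_inner_right[OF P IX])
  finally show ?thesis .
qed

lemma Int_stable_vimage_sets: "Int_stable {V -` A \<inter> \<Omega> | A. A \<in> sets N}"
  unfolding Int_stable_def
proof safe
  fix A B assume "A \<in> sets N" "B \<in> sets N"
  then show "\<exists>C. (V -` A \<inter> \<Omega>) \<inter> (V -` B \<inter> \<Omega>) = V -` C \<inter> \<Omega> \<and> C \<in> sets N"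
    by (intro exI[of _ "A \<inter> B"]) auto
qed

lemma measurable_sigma_of_vimage_sets:
  assumes "V \<in> measurable M N" and "{V -` A \<inter> space M | A. A \<in> sets N} \<subseteq> E"
    and "E \<subseteq> Pow (space M)"
  shows "V \<in> measurable (sigma (space M) E) N"
proof (rule measurableI)
  fix x assume "x \<in> space (sigma (space M) E)"
  then show "V x \<in> space N" using assms(1,3) by (auto simp: space_measure_of measurable_space)
next
  fix A assume "A \<in> sets N"
  then have "V -` A \<inter> space M \<in> E" using assms(2) by blast
  then show "V -` A \<inter> space (sigma (space M) E) \<in> sets (sigma (space M) E)"
    using assms(3) by (simp add: space_measure_of sets_measure_of)
qed

lemma sigma_sets_vimage_sets_subset:
  assumes "g \<in> measurable (sigma \<Omega> E) N" and "E \<subseteq> Pow \<Omega>"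
  shows "sigma_sets \<Omega> {g -` A \<inter> \<Omega> | A. A \<in> sets N} \<subseteq> sigma_sets \<Omega> E"
  using assms
  by (intro sigma_sets_mono) (auto dest: measurable_sets simp: sets_measure_of space_measure_of)

lemma (in prob_space) indep_var_of_indep_sets_pair:
  assumes indep: "indep_sets F I" and idx: "i \<in> I" "j \<in> I" "k \<in> I" "i \<noteq> j" "i \<noteq> k"
    and U: "U \<in> measurable M N1" "F i = {U -` A \<inter> space M | A. A \<in> sets N1}"
    and V: "V \<in> measurable M N2" "F j = {V -` A \<inter> space M | A. A \<in> sets N2}"
    and W: "W \<in> measurable M N3" "F k = {W -` A \<inter> space M | A. A \<in> sets N3}"
    and f: "f \<in> measurable N1 N" and \<phi>: "\<phi> \<in> measurable (N2 \<Otimes>\<^sub>M N3) N"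
  shows "indep_var N (\<lambda>\<omega>. f (U \<omega>)) N (\<lambda>\<omega>. \<phi> (V \<omega>, W \<omega>))"
proof -
  define K where "K b = (if b then {i} else {j, k})" for b
  have "indep_sets F (\<Union>b. K b)"
    by (rule indep_sets_mono_index[OF _ indep]) (use idx in \<open>auto simp: K_def\<close>)
  then have "indep_sets (\<lambda>b. sigma_sets (space M) (\<Union>l\<in>K b. F l)) UNIV"
    by (rule indep_sets_collect_sigma)
       (use U V W idx in \<open>auto simp: K_def disjoint_family_on_def Int_stable_vimage_sets
          split: if_splits\<close>)
  moreover have "(\<lambda>b. sigma_sets (space M) (\<Union>l\<in>K b. F l)) =
      case_bool (sigma_sets (space M) (F i)) (sigma_sets (space M) (F j \<union> F k))"
    by (rule ext) (simp add: K_def split: bool.split)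
  ultimately have indep_ijk:
    "indep_set (sigma_sets (space M) (F i)) (sigma_sets (space M) (F j \<union> F k))"
    unfolding indep_set_def by simp
  have i_space: "F i \<subseteq> Pow (space M)" and jk_space: "F j \<union> F k \<subseteq> Pow (space M)"
    using U V W by (auto dest: measurable_space)
  have "U \<in> measurable (sigma (space M) (F i)) N1"
    using U by (intro measurable_sigma_of_vimage_sets[OF U(1) _ i_space]) simp
  then have "(\<lambda>\<omega>. f (U \<omega>)) \<in> measurable (sigma (space M) (F i)) N"
    using f by (rule measurable_compose)
  then have fU: "sigma_sets (space M) {(\<lambda>\<omega>. f (U \<omega>)) -` A \<inter> space M | A. A \<in> sets N}
      \<subseteq> sigma_sets (space M) (F i)"
    using i_space by (rule sigma_sets_vimage_sets_subset)
  have "(\<lambda>\<omega>. (V \<omega>, W \<omega>)) \<in> measurable (sigma (space M) (F j \<union> F k)) (N2 \<Otimes>\<^sub>M N3)"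
    using measurable_sigma_of_vimage_sets[OF V(1) _ jk_space]
      measurable_sigma_of_vimage_sets[OF W(1) _ jk_space] V(2) W(2)
    by (intro measurable_Pair) auto
  then have "(\<lambda>\<omega>. \<phi> (V \<omega>, W \<omega>)) \<in> measurable (sigma (space M) (F j \<union> F k)) N"
    using \<phi> by (rule measurable_compose)
  then have \<phi>VW: "sigma_sets (space M) {(\<lambda>\<omega>. \<phi> (V \<omega>, W \<omega>)) -` A \<inter> space M | A. A \<in> sets N}
      \<subseteq> sigma_sets (space M) (F j \<union> F k)"
    using jk_space by (rule sigma_sets_vimage_sets_subset)
  have "indep_set (sigma_sets (space M) {(\<lambda>\<omega>. f (U \<omega>)) -` A \<inter> space M | A. A \<in> sets N})
      (sigma_sets (space M) {(\<lambda>\<omega>. \<phi> (V \<omega>, W \<omega>)) -` A \<inter> space M | A. A \<in> sets N})"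
    using indep_ijk unfolding indep_set_def
    by (rule indep_sets_mono_sets) (use fU \<phi>VW in \<open>auto split: bool.split\<close>)
  then show ?thesis
    unfolding indep_var_eq using U(1) V(1) W(1) f \<phi> by simp
qed

lemma indep4_indep_var_pairs:
  assumes "prob_space M" and "indep4 M V1 N1 V2 N2 V3 N3 V4 N4"
  shows "\<And>f \<phi>. f \<in> measurable N1 N \<Longrightarrow> \<phi> \<in> measurable (N2 \<Otimes>\<^sub>M N3) N \<Longrightarrow>
      prob_space.indep_var M N (\<lambda>\<omega>. f (V1 \<omega>)) N (\<lambda>\<omega>. \<phi> (V2 \<omega>, V3 \<omega>))"
    and "\<And>f \<phi>. f \<in> measurable N1 N \<Longrightarrow> \<phi> \<in> measurable (N2 \<Otimes>\<^sub>M N4) N \<Longrightarrow>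
      prob_space.indep_var M N (\<lambda>\<omega>. f (V1 \<omega>)) N (\<lambda>\<omega>. \<phi> (V2 \<omega>, V4 \<omega>))"
proof -
  interpret prob_space M by fact
  define F where "F = (\<lambda>i::nat. [{V1 -` A \<inter> space M | A. A \<in> sets N1},
    {V2 -` A \<inter> space M | A. A \<in> sets N2}, {V3 -` A \<inter> space M | A. A \<in> sets N3},
    {V4 -` A \<inter> space M | A. A \<in> sets N4}] ! i)"
  have meas: "V1 \<in> measurable M N1" "V2 \<in> measurable M N2" "V3 \<in> measurable M N3"
      "V4 \<in> measurable M N4" and indep: "indep_sets F {0..<4}"
    using assms(2) unfolding indep4_def F_def by auto
  have F: "F 0 = {V1 -` A \<inter> space M | A. A \<in> sets N1}" "F 1 = {V2 -` A \<inter> space M | A. A \<in> sets N2}"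
    "F 2 = {V3 -` A \<inter> space M | A. A \<in> sets N3}" "F 3 = {V4 -` A \<inter> space M | A. A \<in> sets N4}"
    by (simp_all add: F_def numeral_eq_Suc)
  show "indep_var N (\<lambda>\<omega>. f (V1 \<omega>)) N (\<lambda>\<omega>. \<phi> (V2 \<omega>, V3 \<omega>))"
    if "f \<in> measurable N1 N" "\<phi> \<in> measurable (N2 \<Otimes>\<^sub>M N3) N" for f \<phi>
    by (rule indep_var_of_indep_sets_pair
        [OF indep _ _ _ _ _ meas(1) F(1) meas(2) F(2) meas(3) F(3) that]) auto
  show "indep_var N (\<lambda>\<omega>. f (V1 \<omega>)) N (\<lambda>\<omega>. \<phi> (V2 \<omega>, V4 \<omega>))"
    if "f \<in> measurable N1 N" "\<phi> \<in> measurable (N2 \<Otimes>\<^sub>M N4) N" for f \<phi>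
    by (rule indep_var_of_indep_sets_pair
        [OF indep _ _ _ _ _ meas(1) F(1) meas(2) F(2) meas(4) F(4) that]) auto
qed

theorem proposition1:
  fixes M :: "'a measure"
    and I :: "'a \<Rightarrow> real^'m" and H :: "'a \<Rightarrow> real^'q"
    and eX :: "'a \<Rightarrow> 'ex" and eY :: "'a \<Rightarrow> 'ey"
    and NX :: "'ex measure" and NY :: "'ey measure"
    and X :: "'a \<Rightarrow> real^'d" and Y :: "'a \<Rightarrow> real"
    and B :: "real^'d^'d" and A :: "real^'m^'d" and \<beta>s :: "real^'d"
    and h :: "(real^'q) \<times> 'ex \<Rightarrow> real^'d" and g :: "(real^'q) \<times> 'ey \<Rightarrow> real"
    and j :: 'd
  assumes "prob_space M"
    and h_meas: "h \<in> borel_measurable (borel \<Otimes>\<^sub>M NX)"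
    and g_meas: "g \<in> borel_measurable (borel \<Otimes>\<^sub>M NY)"
    and indep: "indep4 M I borel H borel eX NX eY NY"
    and invB: "invertible (mat 1 - B)"
    and SCM_X: "\<forall>\<omega>\<in>space M. X \<omega> = B *v X \<omega> + A *v I \<omega> + h (H \<omega>, eX \<omega>)"
    and SCM_Y: "\<forall>\<omega>\<in>space M. Y \<omega> = X \<omega> \<bullet> \<beta>s + g (H \<omega>, eY \<omega>)"
    and I_L2: "\<forall>i. integrable M (\<lambda>\<omega>. I \<omega> $ i) \<and> integrable M (\<lambda>\<omega>. (I \<omega> $ i)\<^sup>2)"
    and X_L2: "\<forall>k. integrable M (\<lambda>\<omega>. X \<omega> $ k) \<and> integrable M (\<lambda>\<omega>. (X \<omega> $ k)\<^sup>2)"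
    and Y_L2: "integrable M Y \<and> integrable M (\<lambda>\<omega>. (Y \<omega>)\<^sup>2)"
    and covI: "invertible (cov_mat M I I)"
  defines "C \<equiv> transpose A ** transpose (matrix_inv (mat 1 - B))"
  shows "(identifiable_coord M I X Y \<beta>s j \<longleftrightarrow> null_coord C j = {0})
       \<and> (null_coord C j = {0} \<longrightarrow>
            \<beta>s $ j = (moore_penrose (cov_mat M I X) *v cov_vec M I Y) $ j)"
proof -
  interpret prob_space M by fact
  have IX: "cov_integrable M (\<lambda>\<omega>. I \<omega> $ i) (\<lambda>\<omega>. X \<omega> $ k)" for i k
    using I_L2 X_L2 by (intro cov_integrable_square) auto
  have II: "cov_integrable M (\<lambda>\<omega>. I \<omega> $ i) (\<lambda>\<omega>. I \<omega> $ p)" for i p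
    using I_L2 by (intro cov_integrable_square) auto
  have indep_W: "indep_var borel (\<lambda>\<omega>. I \<omega> $ i) borel (\<lambda>\<omega>. h (H \<omega>, eX \<omega>) $ l)" for i l
    using measurable_compose[OF h_meas borel_measurable_vec_nth]
    by (rule indep4_indep_var_pairs(1)[OF assms(1) indep borel_measurable_vec_nth])
  have indep_G: "indep_var borel (\<lambda>\<omega>. I \<omega> $ i) borel (\<lambda>\<omega>. g (H \<omega>, eY \<omega>))" for i
    using g_meas by (rule indep4_indep_var_pairs(2)[OF assms(1) indep borel_measurable_vec_nth])
  define K where "K = cov_mat M I X"
  have "K = cov_mat M I I ** C"
    using eq_mult_transpose_matrix_inv
        [OF invB cov_mat_structural_equation[OF assms(1) SCM_X IX II indep_W]]
    by (simp add: K_def C_def matrix_mul_assoc)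
  then have null_K: "null_coord K j = null_coord C j"
    using null_coord_invertible_mult[OF covI] by simp
  have K_residual: "cov_vec M I (\<lambda>\<omega>. Y \<omega> - X \<omega> \<bullet> \<beta>) = K *v (\<beta>s - \<beta>)" for \<beta>
    using cov_vec_structural_equation[OF assms(1) SCM_Y IX _ indep_G] Y_L2 by (simp add: K_def)
  have "moment_solutions M I X Y = {\<beta>. K *v (\<beta>s - \<beta>) = 0}"
    using K_residual by (simp add: moment_solutions_def cov_vec_def vec_eq_iff)
  then have "identifiable_coord M I X Y \<beta>s j \<longleftrightarrow> null_coord C j = {0}"
    unfolding identifiable_coord_def
    using solution_coords_eq_singleton_iff[of j K \<beta>s] null_K by simp
  moreover have "\<beta>s $ j = (moore_penrose K *v cov_vec M I Y) $ j" if "null_coord C j = {0}"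
    using generalized_inverse_coord[of K "moore_penrose K" j \<beta>s] K_residual[of 0] that null_K
      penrose_conditions_moore_penrose[of K] by (simp add: penrose_conditions_def)
  ultimately show ?thesis by (simp add: K_def)
qed

end
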